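(* Let $1\le k\le r$ be integers and let $p_1,\ldots,p_k$ be distinct primes, each of which is congruent to $1$ or $-1$ modulo $5$. Put $b_0=p_1\cdots p_k$ and let $p_{k+1},\ldots,p_r$ be distinct primes, each of which is congruent to $1$ modulo $b_0$. Let $b=p_1\cdots p_r$ and $t=p_{k+1}\cdots p_r$. Then $$\left|\left\{c\in\mathbb{Z}: 1\le c\le b-1,\ \gcd(c,b)=1,\ S(c,b)=\frac{t^2+2}{b}-3\right\}\right|=2^k.$$
   Context: For a natural number $b$ (positive integer) and an integer $c$ with $\gcd(c,b)=1$, the classical Dedekind sum is $s(c,b)=\sum_{k=1}^{b}((k/b))((ck/b))$, where $((x))=x-\lfloor x\rfloor-1/2$ if $x\in\mathbb{R}\setminus\mathbb{Z}$ and $((x))=0$ if $x\in\mathbb{Z}$. The normalized Dedekind sum is $S(c,b)=12\,s(c,b)$. If $k=r$, the list $p_{k+1},\ldots,p_r$ is empty and $t=1$ (empty product). *)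

theory Defs
  imports Complex_Main "HOL-Number_Theory.Number_Theory"
begin

definition sawtooth :: "real \<Rightarrow> real" where
  "sawtooth x = (if x \<in> \<int> then 0 else x - of_int \<lfloor>x\<rfloor> - 1 / 2)"

(* Total functions; the arguments of interest are b > 0 and c coprime to b. *)

definition dedekind_sum :: "int \<Rightarrow> nat \<Rightarrow> real" where
  "dedekind_sum c b =
     (\<Sum>k=1..b. sawtooth (real k / real b) * sawtooth (of_int c * real k / real b))"

definition normalized_dedekind_sum :: "int \<Rightarrow> nat \<Rightarrow> real" where
  "normalized_dedekind_sum c b = 12 * dedekind_sum c b"

end

theory Submission
  imports Defs
begin

text \<open>
  The number \<open>b S(c,b)\<close> is an integer \<open>D\<close> with \<open>c D \<equiv> c\<^sup>2 + 1\<close> modulo \<open>b\<close>. So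
  \<open>S(c,b) = (t\<^sup>2 + 2)/b - 3\<close> forces \<open>b\<close> to divide \<open>(c - 1)\<^sup>2 - c t\<^sup>2\<close>; as \<open>t\<close> is squarefree, this
  means \<open>c = 1 + u t\<close> with \<open>u\<^sup>2 - u t - 1 \<equiv> 0\<close> modulo \<open>b\<^sub>0\<close>. Conversely, for such \<open>c\<close> split the
  summation index of \<open>s(c,b)\<close> as \<open>i + b\<^sub>0 j\<close>. The inner sum over \<open>j\<close> is a polynomial in
  \<open>x = {i/b\<^sub>0}\<close>, \<open>y = {u i/b\<^sub>0}\<close> and \<open>z = {c i/b\<^sub>0} = {u\<^sup>2 i/b\<^sub>0}\<close> whose only mixed terms are
  \<open>x y - z y\<close>, and these cancel in the sum over \<open>i\<close> under the substitution \<open>i \<mapsto> u i\<close>. What remains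
  are power sums. Finally \<open>t \<equiv> 1\<close> modulo \<open>b\<^sub>0\<close>, so the \<open>u\<close> are the roots of \<open>u\<^sup>2 - u - 1\<close> modulo
  \<open>b\<^sub>0\<close>, of which there are two for each prime factor because the discriminant 5 is a
  quadratic residue modulo every prime congruent to 1 or -1 modulo 5.
\<close>

section \<open>Fractional parts of rationals and the action of units on residues\<close>

lemma frac_of_int_divide:
  fixes a n :: int
  assumes "n > 0"
  shows "frac (real_of_int a / real_of_int n) = real_of_int (a mod n) / real_of_int n"
proof -
  have "real_of_int a = real_of_int (n * (a div n) + a mod n)" by simp
  then have "real_of_int a = real_of_int n * real_of_int (a div n) + real_of_int (a mod n)"
    by (simp only: of_int_add of_int_mult)
  moreover have "frac (real_of_int a / real_of_int n) =
      real_of_int a / real_of_int n - real_of_int (a div n)"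
    by (simp only: frac_def floor_divide_of_int_eq)
  ultimately show ?thesis
    using assms by (simp only: add_divide_distrib) simp
qed

lemma frac_divide_mod_cong:
  fixes a a' n :: int
  assumes "n > 0" "[a = a'] (mod n)"
  shows "frac (real_of_int a / real_of_int n) = frac (real_of_int a' / real_of_int n)"
  using assms by (simp add: frac_of_int_divide cong_def)

text \<open>Multiplication by a unit is injective on the residues modulo \<open>n\<close>, hence
  permutes this finite set.\<close>

lemma sum_mult_mod_permute:
  fixes c :: int and n :: nat and h :: "nat \<Rightarrow> 'a::comm_monoid_add"
  assumes "coprime c (int n)" "n > 0"
  shows "(\<Sum>k<n. h (nat ((c * int k) mod int n))) = (\<Sum>k<n. h k)"
proof -
  let ?f = "\<lambda>k. nat ((c * int k) mod int n)"
  have inj: "inj_on ?f {..<n}"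
  proof (rule inj_onI)
    fix x y assume xy: "x \<in> {..<n}" "y \<in> {..<n}" "?f x = ?f y"
    then have "[c * int x = c * int y] (mod int n)"
      using assms(2) by (simp add: cong_def nat_eq_iff2)
    then have "[int x = int y] (mod int n)"
      using assms(1) by (simp add: cong_mult_lcancel)
    then show "x = y"
      using xy by (simp add: cong_def)
  qed
  have "?f ` {..<n} \<subseteq> {..<n}"
    using assms(2) by (auto simp: nat_less_iff)
  then have "?f ` {..<n} = {..<n}"
    using inj by (simp add: endo_inj_surj)
  then show ?thesis
    using inj by (intro sum.reindex_bij_betw) (simp add: bij_betw_def)
qed

lemma sum_frac_permute:
  fixes c :: int and n :: nat and h :: "real \<Rightarrow> 'a::comm_monoid_add"
  assumes "coprime c (int n)" "n > 0"
  shows "(\<Sum>k<n. h (frac (of_int c * real k / real n))) = (\<Sum>k<n. h (real k / real n))"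
proof -
  have "frac (of_int c * real k / real n) = real (nat ((c * int k) mod int n)) / real n" for k
    using frac_of_int_divide[of "int n" "c * int k"] assms(2) by simp
  then show ?thesis
    using sum_mult_mod_permute[OF assms, of "\<lambda>k. h (real k / real n)"] by simp
qed

section \<open>The Dedekind sum via fractional parts, and its residue after clearing
  denominators\<close>

text \<open>Off the integers \<open>sawtooth\<close> is the fractional part minus 1/2, and by
  coprimality \<open>k\<close> and \<open>c k\<close> are multiples of \<open>b\<close> for the same
  \<open>k\<close>. The index \<open>b\<close>, whose term is 0, is traded for the index 0, whose
  term on the right is (-1/2)^2; hence the 1/4.\<close>

lemma dedekind_sum_eq_sum_frac:
  fixes c :: int and b :: nat
  assumes "coprime c (int b)" "b > 0"
  shows "dedekind_sum c b =
    (\<Sum>k<b. (real k / real b - 1/2) * (frac (of_int c * real k / real b) - 1/2)) - 1/4"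
proof -
  let ?g = "\<lambda>k. (real k / real b - 1/2) * (frac (of_int c * real k / real b) - 1/2)"
  let ?s = "\<lambda>k. sawtooth (real k / real b) * sawtooth (of_int c * real k / real b)"
  have not_Ints: "real_of_int a / real b \<notin> \<int>" if "\<not> int b dvd a" for a :: int
  proof
    assume "real_of_int a / real b \<in> \<int>"
    then obtain m where "real_of_int a / real b = of_int m" by (auto elim: Ints_cases)
    then have "real_of_int a = real_of_int (int b * m)" using assms(2) by (simp add: field_simps)
    then have "a = int b * m" by (simp only: of_int_eq_iff)
    then show False using that by simp
  qed
  have eq: "?s k = ?g k" if "k \<in> {1..<b}" for k
  proof -
    have "\<not> int b dvd int k" using that by (auto dest: nat_dvd_not_less)
    moreover from this have "\<not> int b dvd c * int k"
      using assms(1) by (simp add: coprime_dvd_mult_right_iff coprime_commute)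
    ultimately have "real k / real b \<notin> \<int>" "of_int c * real k / real b \<notin> \<int>"
      using not_Ints[of "int k"] not_Ints[of "c * int k"] by simp_all
    moreover have "frac (real k / real b) = real k / real b"
      using that by (simp add: frac_eq)
    ultimately show ?thesis by (simp add: sawtooth_def frac_def)
  qed
  have "dedekind_sum c b = (\<Sum>k\<in>insert b {1..<b}. ?s k)"
    unfolding dedekind_sum_def using assms(2) by (intro sum.cong) auto
  also have "\<dots> = (\<Sum>k\<in>{1..<b}. ?s k)"
    using assms(2) by (simp add: sawtooth_def)
  also have "\<dots> = (\<Sum>k\<in>{1..<b}. ?g k)" by (intro sum.cong eq) auto
  also have "\<dots> = (\<Sum>k\<in>insert 0 {1..<b}. ?g k) - 1/4" by simp
  also have "insert 0 {1..<b} = {..<b}" using assms(2) by auto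
  finally show ?thesis .
qed

lemma sum_real_lessThan: "(\<Sum>k<n. real k) = real n * (real n - 1) / 2"
  by (induction n) (auto simp: field_simps)

lemma sum_real_squares_lessThan:
  "(\<Sum>k<n. (real k)\<^sup>2) = real n * (real n - 1) * (2 * real n - 1) / 6"
  by (induction n) (auto simp: field_simps power2_eq_square)

text \<open>With \<open>q k\<close> the floor of \<open>c k / b\<close>, the Dedekind sum is linear
  in \<open>K\<close>, and multiplying by \<open>12 b\<close> clears all denominators. The
  congruence is stated for \<open>c D\<close> because it is \<open>12 c K\<close> whose residue
  modulo \<open>b\<close> can be read off.\<close>

lemma dedekind_sum_times_modulus_cong:
  fixes c :: int and b :: nat
  assumes "coprime c (int b)" "b > 0"
  obtains D :: int where "of_int D = real b * normalized_dedekind_sum c b"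
    and "[c * D = c\<^sup>2 + 1] (mod int b)"
proof -
  define q where "q k = (c * int k) div int b" for k
  define K where "K = (\<Sum>k<b. int k * q k)"
  define F where "F = (\<Sum>k<b. (q k)\<^sup>2)"
  define T where "T = (\<Sum>k<b. (real k)\<^sup>2)"
  text \<open>The value of \<open>c K\<close> comes from comparing the sum of the squares of the residues
    \<open>c k - b q k\<close> with \<open>T\<close>.\<close>
  define D where "D = 2 * c * (int b - 1) * (2 * int b - 1) - 12 * K - 3 * int b * (int b - 1)"
  have T: "6 * T = real b * (real b - 1) * (2 * real b - 1)"
    by (simp add: T_def sum_real_squares_lessThan)
  have fr: "frac (of_int c * real k / real b) = of_int c * real k / real b - of_int (q k)" for k
    using floor_divide_of_int_eq[of "c * int k" "int b"] by (simp add: frac_def q_def)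
  have K: "real_of_int K = (\<Sum>k<b. real k * of_int (q k))" by (simp add: K_def)
  have F: "real_of_int F = (\<Sum>k<b. (of_int (q k))\<^sup>2)" by (simp add: F_def)
  have S1: "(\<Sum>k<b. frac (of_int c * real k / real b)) = (real b - 1) / 2"
    using sum_frac_permute[OF assms, of "\<lambda>x. x"] assms(2)
    by (simp add: sum_real_lessThan flip: sum_divide_distrib)
  have S2: "(\<Sum>k<b. (frac (of_int c * real k / real b))\<^sup>2) = T / (real b)\<^sup>2"
    using sum_frac_permute[OF assms, of "\<lambda>x. x\<^sup>2"]
    by (simp add: T_def power_divide flip: sum_divide_distrib)
  have "(\<Sum>k<b. (frac (of_int c * real k / real b))\<^sup>2) =
      (\<Sum>k<b. (of_int c)\<^sup>2 / (real b)\<^sup>2 * (real k)\<^sup>2 - 2 * of_int c / real b * (real k * of_int (q k)) + (of_int (q k))\<^sup>2)"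
    unfolding fr by (intro sum.cong refl) (simp add: power2_eq_square algebra_simps)
  also have "\<dots> = (of_int c)\<^sup>2 / (real b)\<^sup>2 * T - 2 * of_int c / real b * of_int K + of_int F"
    by (simp only: T_def K F sum.distrib sum_subtractf flip: sum_distrib_left)
  finally have "T = (of_int c)\<^sup>2 * T - 2 * of_int c * real b * of_int K + (real b)\<^sup>2 * of_int F"
    using assms(2) unfolding S2 by (simp add: field_simps power2_eq_square)
  then have "6 * T = (of_int c)\<^sup>2 * (6 * T) - 12 * of_int c * real b * of_int K + 6 * (real b)\<^sup>2 * of_int F"
    by simp
  \<comment> \<open>Since \<open>6 T\<close> equals \<open>b (b - 1) (2 b - 1)\<close>, every term
    contains the factor \<open>b\<close>; cancelling it leaves \<open>12 c K\<close> known modulo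
    \<open>b\<close>.\<close>
  then have "real b * (12 * of_int c * of_int K) =
      real b * (((of_int c)\<^sup>2 - 1) * (real b - 1) * (2 * real b - 1) + 6 * real b * of_int F)"
    unfolding T by (simp add: algebra_simps power2_eq_square)
  then have "12 * of_int c * of_int K =
      ((of_int c)\<^sup>2 - 1) * (real b - 1) * (2 * real b - 1) + 6 * real b * of_int F"
    using assms(2) by simp
  then have "real_of_int (12 * c * K) =
      real_of_int ((c\<^sup>2 - 1) * (int b - 1) * (2 * int b - 1) + 6 * int b * F)"
    by simp
  then have cK: "12 * c * K = (c\<^sup>2 - 1) * (int b - 1) * (2 * int b - 1) + 6 * int b * F"
    by (simp only: of_int_eq_iff)
  have "c * D = 2 * c\<^sup>2 * (int b - 1) * (2 * int b - 1) - 12 * c * K - 3 * int b * c * (int b - 1)"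
    by (simp add: D_def algebra_simps power2_eq_square)
  \<comment> \<open>Modulo \<open>b\<close> the product \<open>(b - 1) (2 b - 1)\<close> is 1, so
    what survives is 2 c^2 - (c^2 - 1).\<close>
  also have "\<dots> = (c\<^sup>2 + 1) + int b * ((c\<^sup>2 + 1) * (2 * int b - 3) - 6 * F - 3 * c * (int b - 1))"
    unfolding cK by (simp add: algebra_simps power2_eq_square)
  finally have 2: "[c * D = c\<^sup>2 + 1] (mod int b)"
    by (simp add: cong_iff_dvd_diff)
  have "dedekind_sum c b = (\<Sum>k<b. of_int c / (real b)\<^sup>2 * (real k)\<^sup>2 - 1 / real b * (real k * of_int (q k))
      - 1 / (2 * real b) * real k - 1/2 * frac (of_int c * real k / real b) + 1/4) - 1/4"
    unfolding dedekind_sum_eq_sum_frac[OF assms]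
    by (intro arg_cong2[of _ _ _ _ "(-)"] sum.cong refl)
       (simp add: fr power2_eq_square algebra_simps)
  also have "\<dots> = of_int c / (real b)\<^sup>2 * T - 1 / real b * of_int K
      - 1 / (2 * real b) * (real b * (real b - 1) / 2) - 1/2 * ((real b - 1) / 2) + real b / 4 - 1/4"
    by (simp only: sum.distrib sum_subtractf S1 T_def K sum_real_lessThan flip: sum_distrib_left) simp
  finally have s: "dedekind_sum c b = \<dots>" .
  have "real b * normalized_dedekind_sum c b =
      2 * of_int c / real b * (6 * T) - 12 * of_int K - 3 * real b * (real b - 1)"
    unfolding normalized_dedekind_sum_def s using assms(2) by (simp add: field_simps power2_eq_square)
  then have "of_int D = real b * normalized_dedekind_sum c b"
    using assms(2) unfolding T D_def by simp
  then show ?thesis using 2 that by blast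
qed

section \<open>The value of the Dedekind sum at \<open>1 + u t\<close>\<close>

text \<open>Adding \<open>y\<close> to \<open>(x + j) / t\<close> wraps around 1 exactly for the
  last \<open>m\<close> indices, where \<open>m\<close> is the floor of \<open>x + t y\<close>. The
  sum is therefore a full quadratic power sum minus a linear sum over these \<open>m\<close>
  indices, and substituting \<open>m = x + t y - z\<close> gives the polynomial.\<close>

lemma sum_shifted_sawtooth_product:
  fixes x y :: real and t :: nat
  assumes "0 \<le> x" "x < 1" "0 \<le> y" "y < 1" "t > 0"
  defines "z \<equiv> frac (x + real t * y)"
  shows "(\<Sum>j<t. ((x + real j) / real t - 1/2) * (frac ((x + real j) / real t + y) - 1/2)) =
    (x\<^sup>2 + z\<^sup>2) / (2 * real t) + (x + z) * (real t - 1) / (2 * real t)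
      + (real t - 1) * (2 * real t - 1) / (6 * real t) + real t * (y\<^sup>2 - y) / 2 + (z - x) / 2
      - (x + z + real t - 1) / 2 + real t / 4 + x * y - z * y"
proof -
  define m where "m = nat \<lfloor>x + real t * y\<rfloor>"
  have nonneg: "0 \<le> x + real t * y" using assms by simp
  have m: "real m = x + real t * y - z"
    using nonneg by (simp add: m_def z_def frac_def)
  have z: "0 \<le> z" "z < 1" by (simp_all add: z_def frac_lt_1)
  have "real t * y < real t" using assms by simp
  then have "real m < real t + 1" using m z assms by linarith
  then have mt: "m \<le> t" by linarith
  have frac_shift: "frac ((x + real j) / real t + y) =
      (x + real j) / real t + y - (if j < t - m then 0 else 1)" if "j < t" for j
  proof -
    \<comment> \<open>As \<open>x + t y = m + z\<close> with \<open>z\<close> in [0, 1), comparison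
      with 1 reduces to comparing the integers \<open>m + j\<close> and \<open>t\<close>.\<close>
    have val: "(x + real j) / real t + y = (z + real m + real j) / real t"
      using m assms(5) by (simp add: field_simps)
    show ?thesis
    proof (cases "j < t - m")
      case True
      then have "real m + real j + 1 \<le> real t" by linarith
      then have "(x + real j) / real t + y < 1"
        unfolding val using z assms(5) by (simp add: field_simps)
      moreover have "0 \<le> (x + real j) / real t + y" using assms by simp
      ultimately show ?thesis using True by (simp add: frac_eq)
    next
      case False
      then have "real m + real j \<ge> real t" using mt by linarith
      then have 1: "(x + real j) / real t + y \<ge> 1"
        unfolding val using z assms(5) by (simp add: field_simps)
      have "x + real j < real t" using that assms by linarith
      then have "(x + real j) / real t < 1" using assms(5) by simp
      then have "(x + real j) / real t + y < 2" using assms by linarith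
      with 1 have "\<lfloor>(x + real j) / real t + y\<rfloor> = 1" by (simp add: floor_eq_iff)
      then show ?thesis using False by (simp add: frac_def)
    qed
  qed
  let ?f = "\<lambda>j. (x + real j) / real t"
  have lin: "(\<Sum>j<n. ?f j - 1/2) = (real n * x + real n * (real n - 1) / 2) / real t - real n / 2" for n
    by (simp add: sum.distrib sum_subtractf sum_real_lessThan flip: sum_divide_distrib)
  have "(\<Sum>j<t. (?f j)\<^sup>2) = (\<Sum>j<t. x\<^sup>2 / (real t)\<^sup>2 + 2 * x / (real t)\<^sup>2 * real j + 1 / (real t)\<^sup>2 * (real j)\<^sup>2)"
    using assms(5) by (intro sum.cong refl) (simp add: field_simps power2_eq_square)
  also have "\<dots> = real t * (x\<^sup>2 / (real t)\<^sup>2) + 2 * x / (real t)\<^sup>2 * (real t * (real t - 1) / 2)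
      + 1 / (real t)\<^sup>2 * (real t * (real t - 1) * (2 * real t - 1) / 6)"
    by (simp only: sum.distrib sum_real_lessThan sum_real_squares_lessThan sum_constant card_lessThan flip: sum_distrib_left)
  also have "\<dots> = (x\<^sup>2 + x * (real t - 1) + (real t - 1) * (2 * real t - 1) / 6) / real t"
    using assms(5) by (simp add: field_simps power2_eq_square)
  finally have quad: "(\<Sum>j<t. (?f j)\<^sup>2) = \<dots>" .
  have "(\<Sum>j<t-m. ?f j - 1/2) + (\<Sum>j=t-m..<t. ?f j - 1/2) = (\<Sum>j<t. ?f j - 1/2)"
    using sum.atLeastLessThan_concat[of 0 "t - m" t "\<lambda>j. ?f j - 1/2"]
    by (simp only: atLeast0LessThan le0 diff_le_self)
  then have upper: "(\<Sum>j=t-m..<t. ?f j - 1/2) = (\<Sum>j<t. ?f j - 1/2) - (\<Sum>j<t-m. ?f j - 1/2)"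
    by (simp only: eq_diff_eq add.commute)
  have "(\<Sum>j<t. if j \<in> {t-m..<t} then ?f j - 1/2 else 0) = (\<Sum>j=t-m..<t. ?f j - 1/2)"
    by (subst sum.inter_restrict[symmetric]) (auto intro!: sum.cong)
  also have "\<dots> = (real t * x + real t * (real t - 1) / 2) / real t - real t / 2
      - (((real t - real m) * x + (real t - real m) * (real t - real m - 1) / 2) / real t - (real t - real m) / 2)"
    unfolding upper lin using mt by (simp add: of_nat_diff)
  finally have indicator: "(\<Sum>j<t. if j \<in> {t-m..<t} then ?f j - 1/2 else 0) = \<dots>" .
  have "(\<Sum>j<t. (?f j - 1/2) * (frac (?f j + y) - 1/2)) =
      (\<Sum>j<t. (?f j)\<^sup>2 + (y - 1) * (?f j - 1/2) - 1/4 - (if j \<in> {t-m..<t} then ?f j - 1/2 else 0))"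
  proof (intro sum.cong refl)
    fix j assume "j \<in> {..<t}"
    then have j: "j < t" by simp
    define a where "a = ?f j"
    show "(?f j - 1/2) * (frac (?f j + y) - 1/2) =
        (?f j)\<^sup>2 + (y - 1) * (?f j - 1/2) - 1/4 - (if j \<in> {t-m..<t} then ?f j - 1/2 else 0)"
      using j unfolding frac_shift[OF j] unfolding a_def[symmetric]
      by (simp add: power2_eq_square field_simps)
  qed
  also have "\<dots> = (\<Sum>j<t. (?f j)\<^sup>2) + (y - 1) * (\<Sum>j<t. ?f j - 1/2) - real t / 4
      - (\<Sum>j<t. if j \<in> {t-m..<t} then ?f j - 1/2 else 0)"
    by (simp add: sum.distrib sum_subtractf flip: sum_distrib_left)
  also have "\<dots> = (x\<^sup>2 + z\<^sup>2) / (2 * real t) + (x + z) * (real t - 1) / (2 * real t)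
      + (real t - 1) * (2 * real t - 1) / (6 * real t) + real t * (y\<^sup>2 - y) / 2 + (z - x) / 2
      - (x + z + real t - 1) / 2 + real t / 4 + x * y - z * y"
    unfolding quad lin indicator m using assms(5) by (simp add: field_simps power2_eq_square)
  finally show ?thesis .
qed

lemma sum_lessThan_mult:
  fixes f :: "nat \<Rightarrow> 'a::comm_monoid_add"
  shows "(\<Sum>k<n * t. f k) = (\<Sum>i<n. \<Sum>j<t. f (i + n * j))"
proof -
  have "(\<Sum>k<n * t. f k) = (\<Sum>j<t. sum f {j * n..<j * n + n})"
    by (simp add: sum.nat_group mult.commute)
  also have "\<dots> = (\<Sum>j<t. \<Sum>i<n. f (i + n * j))"
  proof (rule sum.cong[OF refl])
    fix j
    have "sum f {0 + j * n..<n + j * n} = (\<Sum>i=0..<n. f (i + j * n))"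
      by (rule sum.shift_bounds_nat_ivl)
    then show "sum f {j * n..<j * n + n} = (\<Sum>i<n. f (i + n * j))"
      by (simp add: add.commute mult.commute atLeast0LessThan)
  qed
  also have "\<dots> = (\<Sum>i<n. \<Sum>j<t. f (i + n * j))" by (rule sum.swap)
  finally show ?thesis .
qed

text \<open>The divisibility says that u^2 is congruent to \<open>c\<close> modulo \<open>n\<close>.
  Hence \<open>u\<close> is a unit modulo \<open>n\<close>, and \<open>x\<close>, \<open>y\<close>,
  \<open>z\<close> all run through the fractions 0, 1/n, ..., (n-1)/n in some order, so their power
  sums agree.\<close>

lemma normalized_dedekind_sum_one_plus:
  fixes u :: int and n t :: nat
  assumes "n > 0" "t > 0" and dvd: "int n dvd u\<^sup>2 - u * int t - 1"
    and cop: "coprime (1 + u * int t) (int (n * t))"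
  shows "normalized_dedekind_sum (1 + u * int t) (n * t) = ((real t)\<^sup>2 + 2) / real (n * t) - 3"
proof -
  define c where "c = 1 + u * int t"
  define x where "x i = real i / real n" for i
  define y where "y i = frac (of_int u * real i / real n)" for i
  define z where "z i = frac (of_int c * real i / real n)" for i
  have cong: "[u * u = c] (mod int n)"
    using dvd by (simp add: cong_iff_dvd_diff c_def power2_eq_square algebra_simps)
  have cop_c: "coprime c (int n)" using cop by (simp add: c_def)
  then have "coprime (u * u) (int n)"
    using cong_imp_coprime[OF cong_sym[OF cong]] by simp
  then have cop_u: "coprime u (int n)" by simp
  have inner: "(\<Sum>j<t. (real (i + n * j) / real (n * t) - 1/2)
        * (frac (of_int c * real (i + n * j) / real (n * t)) - 1/2)) =
      ((x i)\<^sup>2 + (z i)\<^sup>2) / (2 * real t) + (x i + z i) * (real t - 1) / (2 * real t)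
      + (real t - 1) * (2 * real t - 1) / (6 * real t) + real t * ((y i)\<^sup>2 - y i) / 2 + (z i - x i) / 2
      - (x i + z i + real t - 1) / 2 + real t / 4 + x i * y i - z i * y i" if "i < n" for i
  proof -
    have y: "y i = of_int u * real i / real n - of_int \<lfloor>of_int u * real i / real n\<rfloor>"
      by (simp add: y_def frac_def)
    have k: "real (i + n * j) / real (n * t) = (x i + real j) / real t" for j
      using assms by (simp add: x_def field_simps)
    \<comment> \<open>With \<open>c = 1 + u t\<close> the quotient splits as
      \<open>(i + n j) / (n t) + u i / n + u j\<close>; the shift \<open>y i\<close> does not depend
      on \<open>j\<close> modulo 1.\<close>
    have "of_int c * real (i + n * j) / real (n * t) =
        (x i + real j) / real t + y i + of_int (\<lfloor>of_int u * real i / real n\<rfloor> + u * int j)" for j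
      unfolding y using assms by (simp add: x_def c_def field_simps)
    then have ck: "frac (of_int c * real (i + n * j) / real (n * t)) = frac ((x i + real j) / real t + y i)" for j
      by (simp only: frac_add_of_int_right)
    have "of_int c * real i / real n =
        x i + real t * y i + of_int (int t * \<lfloor>of_int u * real i / real n\<rfloor>)"
      unfolding y using assms by (simp add: x_def c_def field_simps)
    then have z: "z i = frac (x i + real t * y i)"
      by (simp only: z_def frac_add_of_int_right)
    show ?thesis
      unfolding k ck z using that assms
      by (intro sum_shifted_sawtooth_product) (simp_all add: x_def y_def frac_lt_1)
  qed
  have xy_zy: "(\<Sum>i<n. x i * y i) = (\<Sum>i<n. z i * y i)"
  proof -
    \<comment> \<open>Replacing \<open>i\<close> by \<open>u i\<close> turns \<open>x\<close> into
      \<open>y\<close>, and \<open>y\<close> into \<open>z\<close> because u^2 is congruent to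
      \<open>c\<close>.\<close>
    have "x (nat ((u * int i) mod int n)) = y i" for i
      using frac_of_int_divide[of "int n" "u * int i"] assms(1) by (simp add: x_def y_def)
    moreover have "y (nat ((u * int i) mod int n)) = z i" for i
    proof -
      have "[u * (u * int i mod int n) = u * u * int i] (mod int n)"
        by (simp add: cong_def mod_mult_right_eq mult.assoc)
      also have "[u * u * int i = c * int i] (mod int n)" using cong by (rule cong_scalar_right)
      finally show ?thesis
        using frac_divide_mod_cong[of "int n" "u * (u * int i mod int n)" "c * int i"] assms(1)
        by (simp add: y_def z_def)
    qed
    ultimately have "(\<Sum>i<n. y i * z i) = (\<Sum>i<n. x i * y i)"
      using sum_mult_mod_permute[OF cop_u assms(1), of "\<lambda>i. x i * y i"] by simp
    then show ?thesis by (simp add: mult.commute)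
  qed
  have X: "(\<Sum>i<n. x i) = (real n - 1) / 2"
    using assms(1) by (simp add: x_def sum_real_lessThan flip: sum_divide_distrib)
  have X2: "(\<Sum>i<n. (x i)\<^sup>2) = (real n - 1) * (2 * real n - 1) / (6 * real n)"
    using assms(1)
    by (simp add: x_def power_divide sum_real_squares_lessThan flip: sum_divide_distrib)
       (simp add: power2_eq_square)
  have Y: "(\<Sum>i<n. y i) = (\<Sum>i<n. x i)" "(\<Sum>i<n. (y i)\<^sup>2) = (\<Sum>i<n. (x i)\<^sup>2)"
    using sum_frac_permute[OF cop_u assms(1), of "\<lambda>x. x"] sum_frac_permute[OF cop_u assms(1), of "\<lambda>x. x\<^sup>2"]
    by (simp_all add: x_def y_def)
  have Z: "(\<Sum>i<n. z i) = (\<Sum>i<n. x i)" "(\<Sum>i<n. (z i)\<^sup>2) = (\<Sum>i<n. (x i)\<^sup>2)"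
    using sum_frac_permute[OF cop_c assms(1), of "\<lambda>x. x"] sum_frac_permute[OF cop_c assms(1), of "\<lambda>x. x\<^sup>2"]
    by (simp_all add: x_def z_def)
  \<comment> \<open>The 1/4 from the index 0 becomes, after multiplication by 12, the 3 subtracted
    in the result.\<close>
  have "dedekind_sum c (n * t) + 1/4 =
      (\<Sum>i<n. \<Sum>j<t. (real (i + n * j) / real (n * t) - 1/2)
        * (frac (of_int c * real (i + n * j) / real (n * t)) - 1/2))"
    using dedekind_sum_eq_sum_frac[of c "n * t"] cop assms(1,2)
    by (simp only: c_def sum_lessThan_mult) simp
  also have "\<dots> = (\<Sum>i<n. ((x i)\<^sup>2 + (z i)\<^sup>2) / (2 * real t) + (x i + z i) * (real t - 1) / (2 * real t)
      + (real t - 1) * (2 * real t - 1) / (6 * real t) + real t * ((y i)\<^sup>2 - y i) / 2 + (z i - x i) / 2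
      - (x i + z i + real t - 1) / 2 + real t / 4 + x i * y i - z i * y i)"
    by (intro sum.cong refl inner) simp
  also have "\<dots> = (\<Sum>i<n. 1 / (2 * real t) * (x i)\<^sup>2 + 1 / (2 * real t) * (z i)\<^sup>2
      + (real t - 1) / (2 * real t) * x i + (real t - 1) / (2 * real t) * z i
      + real t / 2 * (y i)\<^sup>2 - real t / 2 * y i - x i + x i * y i - z i * y i
      + ((real t - 1) * (2 * real t - 1) / (6 * real t) - (real t - 1) / 2 + real t / 4))"
    using assms(2) by (intro sum.cong refl) (simp add: field_simps)
  also have "\<dots> = 1 / (2 * real t) * (\<Sum>i<n. (x i)\<^sup>2) + 1 / (2 * real t) * (\<Sum>i<n. (x i)\<^sup>2)
      + (real t - 1) / (2 * real t) * (\<Sum>i<n. x i) + (real t - 1) / (2 * real t) * (\<Sum>i<n. x i)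
      + real t / 2 * (\<Sum>i<n. (x i)\<^sup>2) - real t / 2 * (\<Sum>i<n. x i) - (\<Sum>i<n. x i)
      + of_nat n * ((real t - 1) * (2 * real t - 1) / (6 * real t) - (real t - 1) / 2 + real t / 4)"
    by (simp only: sum.distrib sum_subtractf Y Z xy_zy sum_constant card_lessThan flip: sum_distrib_left)
       (simp add: algebra_simps)
  also have "\<dots> = ((real t)\<^sup>2 + 2) / (12 * real (n * t))"
    unfolding X X2 using assms(1,2) by (simp add: field_simps power2_eq_square)
  finally show ?thesis
    by (simp add: normalized_dedekind_sum_def c_def)
qed

section \<open>Roots of X^2 - X - 1 modulo a product of distinct primes\<close>

text \<open>X^2 - X - 1 is the minimal polynomial of the golden ratio. Taking least nonnegative
  representatives makes the cardinality count residue classes.\<close>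

definition golden_roots :: "nat \<Rightarrow> int set" where
  "golden_roots n = {u. 0 \<le> u \<and> u < int n \<and> int n dvd u\<^sup>2 - u - 1}"

lemma finite_golden_roots: "finite (golden_roots n)"
  by (rule finite_subset[of _ "{0..<int n}"]) (auto simp: golden_roots_def)

lemma golden_poly_cong:
  fixes u v m :: int
  assumes "[u = v] (mod m)"
  shows "m dvd u\<^sup>2 - u - 1 \<longleftrightarrow> m dvd v\<^sup>2 - v - 1"
proof -
  have "[u\<^sup>2 - u - 1 = v\<^sup>2 - v - 1] (mod m)"
    using assms by (intro cong_diff cong_pow cong_refl)
  then show ?thesis by (rule cong_dvd_iff)
qed

text \<open>By the Chinese remainder theorem, reduction modulo \<open>m\<close> and \<open>n\<close>
  matches the roots modulo \<open>m n\<close> with pairs of roots.\<close>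

lemma card_golden_roots_mult:
  assumes "coprime m n" "m > 0" "n > 0"
  shows "card (golden_roots (m * n)) = card (golden_roots m) * card (golden_roots n)"
proof -
  let ?f = "\<lambda>u. (u mod int m, u mod int n)"
  have "bij_betw ?f (golden_roots (m * n)) (golden_roots m \<times> golden_roots n)"
    unfolding bij_betw_def
  proof (intro conjI inj_onI subset_antisym subsetI)
    fix u v assume *: "u \<in> golden_roots (m * n)" "v \<in> golden_roots (m * n)" "?f u = ?f v"
    then have "[u = v] (mod int m * int n)"
      using assms by (intro coprime_cong_mult) (auto simp: cong_def)
    then show "u = v" using * by (simp add: golden_roots_def cong_def)
  next
    fix w assume "w \<in> ?f ` golden_roots (m * n)"
    then obtain u where u: "u \<in> golden_roots (m * n)" "w = ?f u" by blast
    then have "int m dvd u\<^sup>2 - u - 1" "int n dvd u\<^sup>2 - u - 1"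
      by (auto simp: golden_roots_def elim: dvd_mult_left dvd_mult_right)
    then show "w \<in> golden_roots m \<times> golden_roots n"
      using u(2) assms golden_poly_cong[of "u mod int m" u "int m"] golden_poly_cong[of "u mod int n" u "int n"]
      by (simp add: golden_roots_def cong_def)
  next
    fix w assume "w \<in> golden_roots m \<times> golden_roots n"
    then obtain a b where w: "w = (a, b)" "a \<in> golden_roots m" "b \<in> golden_roots n" by blast
    obtain x where x: "[x = a] (mod int m)" "[x = b] (mod int n)"
      using binary_chinese_remainder_int[of "int m" "int n" a b] assms(1) by auto
    define u where "u = x mod (int m * int n)"
    have u: "[u = a] (mod int m)" "[u = b] (mod int n)"
      using x by (auto simp: u_def cong_def mod_mod_cancel)
    then have "int m dvd u\<^sup>2 - u - 1" "int n dvd u\<^sup>2 - u - 1"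
      using w golden_poly_cong u by (auto simp: golden_roots_def)
    then have "int m * int n dvd u\<^sup>2 - u - 1"
      using assms(1) by (intro divides_mult) auto
    then have "u \<in> golden_roots (m * n)"
      using assms by (simp add: golden_roots_def u_def)
    moreover have "?f u = w"
      using u w by (simp add: cong_def golden_roots_def)
    ultimately show "w \<in> ?f ` golden_roots (m * n)" by blast
  qed
  then show ?thesis by (simp add: bij_betw_same_card card_cartesian_product)
qed

text \<open>Reciprocity reduces the solvability of y^2 = 5 modulo \<open>p\<close> to
  \<open>p\<close> being a square modulo 5, which 1 and -1 = 2^2 are. A square root \<open>s\<close>
  of the discriminant 5 then gives the root \<open>(s + 1) / 2\<close>, and its companion is
  \<open>1 - u\<close>.\<close>

lemma card_golden_roots_prime:
  fixes p :: nat
  assumes "prime p" and mod5: "[int p = 1] (mod 5) \<or> [int p = -1] (mod 5)"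
  shows "card (golden_roots p) = 2"
proof -
  have "p \<noteq> 2" "p \<noteq> 5" using mod5 by (auto simp: cong_def)
  then have p: "p > 2" "p \<noteq> 5" "odd p"
    using assms(1) prime_ge_2_nat[of p] prime_odd_nat by force+
  have prime5: "prime (5::nat)" by simp
  have "Legendre (int p) 5 = 1"
  proof -
    have "QuadRes 5 (int p)"
      unfolding QuadRes_def
    proof (cases "[int p = 1] (mod 5)")
      case True
      then show "\<exists>y. [y\<^sup>2 = int p] (mod 5)" by (intro exI[of _ 1]) (simp add: cong_sym)
    next
      case False
      with mod5 have "[int p = -1] (mod 5)" by simp
      moreover have "[2\<^sup>2 = (-1::int)] (mod 5)" by (simp add: cong_def)
      ultimately show "\<exists>y. [y\<^sup>2 = int p] (mod 5)" by (meson cong_sym cong_trans)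
    qed
    moreover have "\<not> [int p = 0] (mod 5)" using mod5 by (auto simp: cong_def)
    ultimately show ?thesis by (simp add: Legendre_def)
  qed
  \<comment> \<open>The sign is +1 because the factor \<open>(5 - 1) div 2\<close> makes the
    exponent even.\<close>
  moreover have "Legendre (int p) (int 5) * Legendre (int 5) (int p) = (-1) ^ ((p - 1) div 2 * ((5 - 1) div 2))"
    using Quadratic_Reciprocity[of 5 p] p assms(1) prime5 by (simp add: mult.commute)
  ultimately have "Legendre 5 (int p) = 1" by (simp add: minus_one_power_iff)
  then have "QuadRes (int p) 5" by (auto simp: Legendre_def split: if_splits)
  then obtain y where y: "[y\<^sup>2 = 5] (mod int p)" by (auto simp: QuadRes_def)
  \<comment> \<open>Adding the odd number \<open>p\<close> corrects the parity, so that
    \<open>(s + 1) / 2\<close> is an integer.\<close>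
  define s where "s = (if odd y then y else y + int p)"
  have s: "[s\<^sup>2 = 5] (mod int p)" "odd s"
  proof -
    have "[s = y] (mod int p)" by (simp add: s_def cong_def)
    then show "[s\<^sup>2 = 5] (mod int p)" using y cong_pow cong_trans by blast
    show "odd s" using p(3) by (simp add: s_def)
  qed
  then obtain v where v: "s = 2 * v + 1" by (elim oddE)
  define u where "u = v + 1"
  have s_u: "s = 2 * u - 1" by (simp add: v u_def)
  have prime: "prime (int p)" using assms(1) by simp
  have "int p dvd s\<^sup>2 - 5" using s(1) by (simp add: cong_iff_dvd_diff)
  also have "s\<^sup>2 - 5 = 2 * (2 * (u\<^sup>2 - u - 1))" by (simp add: s_u power2_eq_square algebra_simps)
  finally have "int p dvd 2 * (2 * (u\<^sup>2 - u - 1))" .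
  moreover have "\<not> int p dvd 2" using p(1) by (auto dest: zdvd_imp_le)
  ultimately have u: "int p dvd u\<^sup>2 - u - 1" using prime by (simp only: prime_dvd_mult_iff) simp
  \<comment> \<open>If the two roots coincided, \<open>p\<close> would divide their difference
    \<open>2 u - 1 = s\<close>, hence also 5.\<close>
  have distinct: "\<not> [u = 1 - u] (mod int p)"
  proof
    assume "[u = 1 - u] (mod int p)"
    then have "int p dvd s" by (simp add: cong_iff_dvd_diff s_u)
    then have "int p dvd s\<^sup>2" by (simp add: power2_eq_square)
    with \<open>int p dvd s\<^sup>2 - 5\<close> have "int p dvd 5" by (metis dvd_diff_right_iff)
    then have "p dvd 5" by (metis int_dvd_int_iff of_nat_numeral)
    then show False using p assms(1) prime5 by (simp add: primes_dvd_imp_eq)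
  qed
  have roots: "int p dvd w\<^sup>2 - w - 1 \<longleftrightarrow> [w = u] (mod int p) \<or> [w = 1 - u] (mod int p)" for w
  proof -
    have "int p dvd w\<^sup>2 - w - 1 \<longleftrightarrow> int p dvd (w\<^sup>2 - w - 1) - (u\<^sup>2 - u - 1)"
      using dvd_diff_left_iff[OF u] by (rule sym)
    also have "(w\<^sup>2 - w - 1) - (u\<^sup>2 - u - 1) = (w - u) * (w - (1 - u))"
      by (simp add: power2_eq_square algebra_simps)
    finally show ?thesis
      using prime by (simp add: prime_dvd_mult_iff cong_iff_dvd_diff)
  qed
  have "golden_roots p = {u mod int p, (1 - u) mod int p}"
    using p(1) unfolding golden_roots_def roots by (auto simp: cong_def)
  moreover have "u mod int p \<noteq> (1 - u) mod int p" using distinct by (simp add: cong_def)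
  ultimately show ?thesis by simp
qed

lemma card_golden_roots_prod_primes:
  fixes p :: "'a \<Rightarrow> nat"
  assumes "finite A" "\<And>i. i \<in> A \<Longrightarrow> prime (p i)" "inj_on p A"
    and "\<And>i. i \<in> A \<Longrightarrow> [int (p i) = 1] (mod 5) \<or> [int (p i) = -1] (mod 5)"
  shows "card (golden_roots (\<Prod>i\<in>A. p i)) = 2 ^ card A"
  using assms
proof (induction A rule: finite_induct)
  case empty
  \<comment> \<open>Modulo 1 every divisibility holds, so the single residue 0 counts as a
    root.\<close>
  have "golden_roots 1 = {0}" by (auto simp: golden_roots_def)
  then show ?case by simp
next
  case (insert a A)
  have "coprime (p a) (\<Prod>i\<in>A. p i)"
    using insert.hyps insert.prems by (intro prod_coprime_right primes_coprime) (auto dest: inj_onD)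
  moreover have "(\<Prod>i\<in>A. p i) > 0" "p a > 0"
    using insert.prems(1) by (auto intro!: prod_pos simp: prime_gt_0_nat)
  moreover have "card (golden_roots (\<Prod>i\<in>A. p i)) = 2 ^ card A"
    using insert.prems by (intro insert.IH) auto
  ultimately show ?case
    using insert.hyps insert.prems by (simp add: card_golden_roots_mult card_golden_roots_prime)
qed

section \<open>From the prescribed value to the number of solutions\<close>

text \<open>Each prime factor passes from the power to its base, and distinct primes, being coprime,
  recombine into their product.\<close>

lemma prod_primes_dvd_of_dvd_power:
  fixes x :: int and p :: "'a \<Rightarrow> nat"
  assumes "finite A" "\<And>i. i \<in> A \<Longrightarrow> prime (p i)" "inj_on p A"
    and "int (\<Prod>i\<in>A. p i) dvd x ^ n"
  shows "int (\<Prod>i\<in>A. p i) dvd x"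
  using assms
proof (induction A rule: finite_induct)
  case (insert a A)
  have "coprime (p a) (\<Prod>i\<in>A. p i)"
    using insert.hyps insert.prems by (intro prod_coprime_right primes_coprime) (auto dest: inj_onD)
  moreover have "int (p a) dvd x"
    using insert.prems(1)[of a] insert.prems(3) insert.hyps
    by (auto intro: prime_dvd_power dvd_mult_left)
  moreover have "int (\<Prod>i\<in>A. p i) dvd x"
    using insert.prems insert.hyps by (intro insert.IH) (auto intro: dvd_mult_right)
  ultimately show ?case
    using insert.hyps by (simp add: divides_mult flip: of_nat_prod)
qed auto

theorem theorem3:
  fixes k r b\<^sub>0 b t :: nat and p :: "nat \<Rightarrow> nat"
  assumes "1 \<le> k" and "k \<le> r"
    and "\<forall>i\<in>{1..k}. prime (p i)"
    and "inj_on p {1..k}"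
    and "\<forall>i\<in>{1..k}. [int (p i) = 1] (mod 5) \<or> [int (p i) = - 1] (mod 5)"
    and "b\<^sub>0 = (\<Prod>i=1..k. p i)"
    and "\<forall>i\<in>{k+1..r}. prime (p i)"
    and "inj_on p {k+1..r}"
    and "\<forall>i\<in>{k+1..r}. [p i = 1] (mod b\<^sub>0)"
    and "b = (\<Prod>i=1..r. p i)"
    and "t = (\<Prod>i=k+1..r. p i)"
  shows "card {c :: int. 1 \<le> c \<and> c \<le> int b - 1 \<and> coprime c (int b) \<and>
           normalized_dedekind_sum c b = ((real t)\<^sup>2 + 2) / real b - 3} = 2 ^ k"
proof -
  let ?C = "{c :: int. 1 \<le> c \<and> c \<le> int b - 1 \<and> coprime c (int b) \<and>
           normalized_dedekind_sum c b = ((real t)\<^sup>2 + 2) / real b - 3}"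
  have b: "b = b\<^sub>0 * t"
  proof -
    have "{1..r} = {1..k} \<union> {k+1..r}" using assms(1,2) by auto
    then show ?thesis
      unfolding assms(6,10,11) by (simp only:) (rule prod.union_disjoint; auto)
  qed
  \<comment> \<open>Since \<open>k\<close> is at least 1 there is a prime factor, so
    \<open>b\<^sub>0 > 1\<close>; this later excludes \<open>c = b\<close>.\<close>
  have "p 1 dvd b\<^sub>0" using assms(1) unfolding assms(6) by (intro dvd_prodI) auto
  moreover have "prime (p 1)" using assms(1,3) by simp
  moreover have b\<^sub>0_pos: "b\<^sub>0 > 0" using assms(3) unfolding assms(6) by (auto intro!: prod_pos simp: prime_gt_0_nat)
  ultimately have b\<^sub>0: "b\<^sub>0 > 1" by (meson dvd_imp_le le_less_trans less_le_trans prime_gt_1_nat)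
  have t: "t > 0" using assms(7) unfolding assms(11) by (auto intro!: prod_pos simp: prime_gt_0_nat)
  have "[t = (\<Prod>i=k+1..r. 1)] (mod b\<^sub>0)"
    unfolding assms(11) using assms(9) by (intro cong_prod) auto
  then have t_cong: "[t = 1] (mod b\<^sub>0)" by simp
  then have cop: "coprime t b\<^sub>0" using cong_imp_coprime[OF cong_sym] by fastforce
  have int_t_cong: "[int t = 1] (mod int b\<^sub>0)"
    using t_cong by (metis cong_int_iff of_nat_1)
  have dvd_iff: "int b\<^sub>0 dvd u\<^sup>2 - u * int t - 1 \<longleftrightarrow> int b\<^sub>0 dvd u\<^sup>2 - u - 1" for u
  proof -
    have "[u\<^sup>2 - u * int t - 1 = u\<^sup>2 - u * 1 - 1] (mod int b\<^sub>0)"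
      by (intro cong_diff cong_mult cong_refl int_t_cong)
    then show ?thesis by (simp add: cong_dvd_iff)
  qed
  have "?C = (\<lambda>u. 1 + u * int t) ` golden_roots b\<^sub>0"
  proof (intro subset_antisym subsetI)
    fix c assume c: "c \<in> ?C"
    obtain D where D: "of_int D = real b * normalized_dedekind_sum c b"
        "[c * D = c\<^sup>2 + 1] (mod int b)"
      using dedekind_sum_times_modulus_cong[of c b] c b b\<^sub>0_pos t by auto
    have "real_of_int D = real_of_int ((int t)\<^sup>2 + 2 - 3 * int b)"
      using D(1) c b b\<^sub>0_pos t by (simp add: field_simps)
    then have "D = (int t)\<^sup>2 + 2 - 3 * int b" by (simp only: of_int_eq_iff)
    then have "c * D - c * ((int t)\<^sup>2 + 2) = int b * (- 3 * c)"
      by (simp only:) (simp add: algebra_simps)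
    then have "[c * D = c * ((int t)\<^sup>2 + 2)] (mod int b)"
      unfolding cong_iff_dvd_diff by simp
    then have "[c\<^sup>2 + 1 = c * ((int t)\<^sup>2 + 2)] (mod int b)"
      using D(2) cong_sym cong_trans by blast
    \<comment> \<open>Subtracting \<open>2 c\<close> from both sides completes the square on the
      left.\<close>
    then have dvd: "int b dvd (c - 1)\<^sup>2 - c * (int t)\<^sup>2"
      by (simp add: cong_iff_dvd_diff power2_eq_square algebra_simps)
    moreover have "int t dvd int b" by (simp add: b)
    ultimately have "int t dvd (c - 1)\<^sup>2 - c * (int t)\<^sup>2" by (rule dvd_trans[rotated])
    moreover have "int t dvd c * (int t)\<^sup>2" by (simp add: power2_eq_square)
    \<comment> \<open>Modulo \<open>t\<close> only the square remains, and \<open>t\<close> is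
      squarefree.\<close>
    ultimately have "int t dvd (c - 1)\<^sup>2" by (simp only: dvd_diff_left_iff)
    then have "int t dvd c - 1"
      using assms(7,8) finite_atLeastAtMost prod_primes_dvd_of_dvd_power[of "{k+1..r}" p "c - 1" 2]
      unfolding assms(11) by blast
    then obtain u where "c - 1 = int t * u" by (elim dvdE)
    then have u: "c = 1 + u * int t" by (simp add: algebra_simps)
    have "int b\<^sub>0 dvd (c - 1)\<^sup>2 - c * (int t)\<^sup>2"
      by (rule dvd_trans[OF _ dvd]) (simp add: b)
    also have "(c - 1)\<^sup>2 - c * (int t)\<^sup>2 = (int t)\<^sup>2 * (u\<^sup>2 - u * int t - 1)"
      by (simp add: u power2_eq_square algebra_simps)
    finally have "int b\<^sub>0 dvd (int t)\<^sup>2 * (u\<^sup>2 - u * int t - 1)" .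
    \<comment> \<open>The factor t^2 is a unit modulo \<open>b\<^sub>0\<close> and can be
      cancelled.\<close>
    moreover have "coprime (int b\<^sub>0) ((int t)\<^sup>2)" using cop by (simp add: coprime_commute)
    ultimately have "int b\<^sub>0 dvd u\<^sup>2 - u - 1"
      by (simp add: coprime_dvd_mult_right_iff dvd_iff)
    moreover have "0 \<le> u * int t" "u * int t < int b\<^sub>0 * int t"
      using c u b by auto
    then have "0 \<le> u" "u < int b\<^sub>0" using t by (auto simp: zero_le_mult_iff)
    ultimately show "c \<in> (\<lambda>u. 1 + u * int t) ` golden_roots b\<^sub>0"
      using u by (auto simp: golden_roots_def)
  next
    fix c assume "c \<in> (\<lambda>u. 1 + u * int t) ` golden_roots b\<^sub>0"
    then obtain u where c: "c = 1 + u * int t" and u: "0 \<le> u" "u < int b\<^sub>0" "int b\<^sub>0 dvd u\<^sup>2 - u - 1"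
      by (auto simp: golden_roots_def)
    have dvd: "int b\<^sub>0 dvd u\<^sup>2 - u * int t - 1" using u by (simp add: dvd_iff)
    have "[u * u = c] (mod int b\<^sub>0)"
      using dvd by (simp add: cong_iff_dvd_diff c power2_eq_square algebra_simps)
    moreover have "coprime (u * u) (int b\<^sub>0)"
    proof -
      \<comment> \<open>The equation itself exhibits \<open>u - 1\<close> as an inverse of
        \<open>u\<close>.\<close>
      have "[u * (u - 1) = 1] (mod int b\<^sub>0)"
        using u(3) by (simp add: cong_iff_dvd_diff power2_eq_square algebra_simps)
      then have "coprime (u * (u - 1)) (int b\<^sub>0)" using cong_imp_coprime[OF cong_sym] by fastforce
      then show ?thesis by simp
    qed
    ultimately have "coprime c (int b\<^sub>0)" by (rule cong_imp_coprime)
    moreover have "coprime c (int t)"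
    proof -
      have "[c = 1] (mod int t)" by (simp add: c cong_iff_dvd_diff)
      then show ?thesis using cong_imp_coprime[OF cong_sym] by fastforce
    qed
    ultimately have cop_c: "coprime c (int b)" by (simp add: b)
    have "c \<ge> 1" using u(1) by (simp add: c)
    moreover have "c \<le> int b - 1"
    proof -
      \<comment> \<open>As \<open>t\<close> is at least 1, \<open>c = 1 + u t\<close> is at most
        \<open>(u + 1) t\<close>. This bounds \<open>c\<close> only by \<open>b\<close>; equality is
        ruled out by coprimality with \<open>b > 1\<close>.\<close>
      have "(u + 1) * int t \<le> int b\<^sub>0 * int t" using u(2) by (intro mult_right_mono) auto
      then have "c \<le> int b" using t by (simp add: b c algebra_simps)
      moreover have "c \<noteq> int b"
        using cop_c b\<^sub>0 t by (auto simp: b)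
      ultimately show ?thesis by simp
    qed
    moreover have "normalized_dedekind_sum c b = ((real t)\<^sup>2 + 2) / real b - 3"
      using normalized_dedekind_sum_one_plus[OF b\<^sub>0_pos t dvd] cop_c by (simp add: b c)
    ultimately show "c \<in> ?C" using cop_c by simp
  qed
  moreover have "inj (\<lambda>u. 1 + u * int t)" using t by (auto intro: injI)
  ultimately have "card ?C = card (golden_roots b\<^sub>0)"
    by (simp add: card_image inj_on_subset)
  also have "\<dots> = 2 ^ k"
    using card_golden_roots_prod_primes[of "{1..k}" p] assms(3,4,5,6) by simp
  finally show ?thesis .
qed

end
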